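(* Let $\mathcal Q$ be a logic on a Hilbert space $\mathcal H$ and $\mathcal A\subseteq\mathcal Q$. Then $$\mathrm{cdom}(\mathcal A)=\mathcal P\{\psi\in\mathcal H:[X,Y]\psi=0\text{ for all }X,Y\in\mathcal A''\},$$ where $\mathcal A''$ is the double commutant of $\mathcal A$ in the algebra of bounded operators on $\mathcal H$.
   Context: $\mathcal Q(\mathcal H)$ is the lattice of orthogonal projections on $\mathcal H$, ordered by inclusion of ranges, with $\wedge$ and $\bigvee$ the projections onto the intersection / closed linear span of the union of ranges. $\mathcal P S$ is the orthogonal projection onto a closed subspace $S$; $[X,Y]=XY-YX$. For $\mathcal A\subseteq\mathcal Q(\mathcal H)$, $\mathcal A^!=\{P\in\mathcal Q(\mathcal H):PQ=QP\ \forall Q\in\mathcal A\}$; a logic is $\mathcal Q\subseteq\mathcal Q(\mathcal H)$ with $\mathcal Q=\mathcal Q^{!!}$. $\mathrm{cdom}(\mathcal A)=\bigvee\{E\in\mathcal A^!\cap\mathcal Q: (P_1\wedge E)(P_2\wedge E)=(P_2\wedge E)(P_1\wedge E)\text{ for all }P_1,P_2\in\mathcal A\}$ (this does not depend on the logic $\mathcal Q\supseteq\mathcal A$). *)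

theory Defs
  imports "HOL-Analysis.Analysis"
begin

class complex_vector = real_vector +
  fixes scaleC :: "complex \<Rightarrow> 'a \<Rightarrow> 'a"
  assumes scaleC_add_right: "scaleC a (x + y) = scaleC a x + scaleC a y"
    and scaleC_add_left: "scaleC (a + b) x = scaleC a x + scaleC b x"
    and scaleC_scaleC: "scaleC a (scaleC b x) = scaleC (a * b) x"
    and scaleC_of_real: "scaleC (complex_of_real r) x = r *\<^sub>R x"

global_interpretation complex_vector: vector_space "scaleC :: complex \<Rightarrow> 'a \<Rightarrow> 'a::complex_vector"
  defines cspan = complex_vector.span
    and csubspace = complex_vector.subspace
proof unfold_locales
  show "scaleC 1 x = x" for x :: 'a
    using scaleC_of_real[of 1 x] by simp
qed (simp_all add: scaleC_add_right scaleC_add_left scaleC_scaleC)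

text \<open>Complex Hilbert spaces of arbitrary dimension (zero and nonseparable ones included). The inner
  product is conjugate linear in its first argument.\<close>

class complex_hilbert_space = complex_vector + banach +
  fixes cinner :: "'a \<Rightarrow> 'a \<Rightarrow> complex"
  assumes cinner_commute: "cinner x y = cnj (cinner y x)"
    and cinner_add_right: "cinner x (y + z) = cinner x y + cinner x z"
    and cinner_scaleC_right: "cinner x (scaleC c y) = c * cinner x y"
    and cinner_ge_zero: "0 \<le> Re (cinner x x)"
    and cinner_eq_zero_iff: "cinner x x = 0 \<longleftrightarrow> x = 0"
    and norm_eq_sqrt_cinner: "norm x = sqrt (Re (cinner x x))"

definition bounded_ops :: "('a \<Rightarrow> 'a::complex_hilbert_space) set" where
  "bounded_ops = {T. bounded_linear T \<and> (\<forall>c x. T (scaleC c x) = scaleC c (T x))}"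

definition commutant :: "('a \<Rightarrow> 'a) set \<Rightarrow> ('a \<Rightarrow> 'a::complex_hilbert_space) set" where
  "commutant \<A> = {T \<in> bounded_ops. \<forall>S\<in>\<A>. T \<circ> S = S \<circ> T}"

definition commutator :: "('a \<Rightarrow> 'a) \<Rightarrow> ('a \<Rightarrow> 'a) \<Rightarrow> 'a \<Rightarrow> 'a::complex_hilbert_space" where
  "commutator X Y = (\<lambda>\<psi>. X (Y \<psi>) - Y (X \<psi>))"

definition projections :: "('a \<Rightarrow> 'a::complex_hilbert_space) set" where
  "projections = {P \<in> bounded_ops. P \<circ> P = P \<and> (\<forall>x y. cinner (P x) y = cinner x (P y))}"

text \<open>Orthogonal projection onto \<open>S\<close>; meaningful only for a closed complex subspace \<open>S\<close>.\<close>

definition proj :: "'a set \<Rightarrow> 'a \<Rightarrow> 'a::complex_hilbert_space" where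
  "proj S x = (THE y. y \<in> S \<and> (\<forall>z\<in>S. cinner z (x - y) = 0))"

definition pmeet :: "('a \<Rightarrow> 'a) \<Rightarrow> ('a \<Rightarrow> 'a) \<Rightarrow> 'a \<Rightarrow> 'a::complex_hilbert_space" where
  "pmeet P Q = proj (range P \<inter> range Q)"

definition pJoin :: "('a \<Rightarrow> 'a) set \<Rightarrow> 'a \<Rightarrow> 'a::complex_hilbert_space" where
  "pJoin \<F> = proj (closure (cspan (\<Union>P\<in>\<F>. range P)))"

definition pcommutant :: "('a \<Rightarrow> 'a) set \<Rightarrow> ('a \<Rightarrow> 'a::complex_hilbert_space) set" where
  "pcommutant \<A> = {P \<in> projections. \<forall>Q\<in>\<A>. P \<circ> Q = Q \<circ> P}"

definition quantum_logic :: "('a \<Rightarrow> 'a::complex_hilbert_space) set \<Rightarrow> bool" where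
  "quantum_logic \<Q> \<longleftrightarrow> \<Q> \<subseteq> projections \<and> \<Q> = pcommutant (pcommutant \<Q>)"

text \<open>The commutativity domain, taken relative to a logic \<open>\<Q>\<close> containing \<open>\<A>\<close>.\<close>

definition cdom :: "('a \<Rightarrow> 'a) set \<Rightarrow> ('a \<Rightarrow> 'a) set \<Rightarrow> 'a \<Rightarrow> 'a::complex_hilbert_space" where
  "cdom \<Q> \<A> = pJoin {E \<in> pcommutant \<A> \<inter> \<Q>.
     \<forall>P1\<in>\<A>. \<forall>P2\<in>\<A>. pmeet P1 E \<circ> pmeet P2 E = pmeet P2 E \<circ> pmeet P1 E}"

end

theory Submission
  imports Defs
begin

text \<open>
  Let \<open>N\<close> be the set of all \<open>\<psi>\<close> annihilated by the commutators of \<open>\<A>''\<close>. If \<open>E\<close> commutes with \<open>\<A>\<close> and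
  the projections in \<open>\<A>\<close> commute with each other on the range of \<open>E\<close>, then \<open>P E \<in> \<A>'\<close> for every
  \<open>P \<in> \<A>\<close>; hence every \<open>X \<in> \<A>''\<close> commutes with all these \<open>P E\<close>, so that \<open>X E \<in> \<A>'\<close>, and therefore
  \<open>Y X E = X E Y = X Y E\<close> for \<open>Y \<in> \<A>''\<close>. So the range of \<open>E\<close> lies in \<open>N\<close>. Conversely, \<open>N\<close> is a closed
  subspace that is invariant under \<open>\<A>''\<close> and under \<open>\<A>'\<close>. The projection onto \<open>N\<close> thus commutes with
  \<open>\<A>\<close> and with \<open>\<Q>\<^sup>!\<close>, so it belongs to \<open>\<Q> = \<Q>\<^sup>!\<^sup>!\<close> and is the largest element of the family
  whose join is the commutativity domain.
\<close>

section \<open>Orthogonal projections in complex Hilbert spaces\<close>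

lemma cinner_add_left:
  fixes x y z :: "'a::complex_hilbert_space"
  shows "cinner (x + y) z = cinner x z + cinner y z"
  by (metis cinner_add_right cinner_commute complex_cnj_add)

lemma cinner_scaleC_left:
  fixes x y :: "'a::complex_hilbert_space"
  shows "cinner (scaleC c x) y = cnj c * cinner x y"
  by (metis cinner_scaleC_right cinner_commute complex_cnj_mult)

lemma cinner_zero_right [simp]: "cinner (x::'a::complex_hilbert_space) 0 = 0"
  using cinner_add_right[of x 0 0] by simp

lemma cinner_diff_right:
  fixes x y z :: "'a::complex_hilbert_space"
  shows "cinner x (y - z) = cinner x y - cinner x z"
  using cinner_add_right[of x "y - z" z] by simp

lemma cinner_diff_left:
  fixes x y z :: "'a::complex_hilbert_space"
  shows "cinner (x - y) z = cinner x z - cinner y z"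
  using cinner_add_left[of "x - y" y z] by simp

lemma norm_sq_eq_cinner:
  fixes x :: "'a::complex_hilbert_space"
  shows "(norm x)\<^sup>2 = Re (cinner x x)"
  by (simp add: norm_eq_sqrt_cinner cinner_ge_zero)

lemma norm_sq_add:
  fixes x y :: "'a::complex_hilbert_space"
  shows "(norm (x + y))\<^sup>2 = (norm x)\<^sup>2 + 2 * Re (cinner x y) + (norm y)\<^sup>2"
proof -
  have "Re (cinner y x) = Re (cinner x y)"
    by (metis cinner_commute cnj.simps(1))
  then show ?thesis
    by (simp add: norm_sq_eq_cinner cinner_add_left cinner_add_right)
qed

lemma norm_sq_diff:
  fixes x y :: "'a::complex_hilbert_space"
  shows "(norm (x - y))\<^sup>2 = (norm x)\<^sup>2 - 2 * Re (cinner x y) + (norm y)\<^sup>2"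
  using norm_sq_add[of "x - y" y]
  by (simp add: cinner_diff_left) (simp add: norm_sq_eq_cinner)

section \<open>Nearest points in closed subspaces and the orthogonal decomposition\<close>

lemma parallelogram_law:
  fixes x y :: "'a::complex_hilbert_space"
  shows "(norm (x + y))\<^sup>2 + (norm (x - y))\<^sup>2 = 2 * (norm x)\<^sup>2 + 2 * (norm y)\<^sup>2"
  by (simp add: norm_sq_add norm_sq_diff)

lemma csubspace_scaleR:
  assumes "csubspace S" "x \<in> S"
  shows "r *\<^sub>R x \<in> S"
  using complex_vector.subspace_scale[OF assms, of "complex_of_real r"]
  by (simp add: scaleC_of_real)

text \<open>A minimizing sequence in \<open>S\<close> is Cauchy by the parallelogram law, because
  midpoints of its members stay in \<open>S\<close>. Completeness gives a limit, and closedness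
  keeps it in \<open>S\<close>.\<close>

lemma csubspace_nearest_point:
  fixes S :: "'a::complex_hilbert_space set"
  assumes S: "csubspace S" and "closed S"
  obtains y where "y \<in> S" "\<And>s. s \<in> S \<Longrightarrow> norm (x - y) \<le> norm (x - s)"
proof -
  define d where "d = infdist x S"
  have ne: "S \<noteq> {}"
    using complex_vector.subspace_0[OF S] by auto
  have d_le: "d \<le> norm (x - s)" if "s \<in> S" for s
    unfolding d_def using infdist_le[OF that] by (simp add: dist_norm)
  have d0: "d \<ge> 0"
    by (simp add: d_def infdist_nonneg)
  have bdd: "bdd_below (dist x ` S)"
    by (rule bdd_belowI2[of _ 0]) simp
  have "\<exists>s. s \<in> S \<and> norm (x - s) < d + inverse (real (Suc n))" for n
  proof -
    have "(INF s\<in>S. dist x s) < d + inverse (real (Suc n))"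
      using ne by (simp add: d_def infdist_notempty)
    then show ?thesis
      unfolding cINF_less_iff[OF ne bdd] by (auto simp: dist_norm)
  qed
  then obtain s where s: "\<And>n. s n \<in> S" "\<And>n. norm (x - s n) < d + inverse (real (Suc n))"
    using choice[of "\<lambda>n s. s \<in> S \<and> norm (x - s) < d + inverse (real (Suc n))"] by blast
  have lim: "(\<lambda>n. norm (x - s n)) \<longlonglongrightarrow> d"
  proof (rule tendsto_sandwich)
    show "\<forall>\<^sub>F n in sequentially. d \<le> norm (x - s n)"
      using d_le s(1) by simp
    show "\<forall>\<^sub>F n in sequentially. norm (x - s n) \<le> d + inverse (real (Suc n))"
      using s(2) by (intro always_eventually allI less_imp_le)
    show "(\<lambda>n. d + inverse (real (Suc n))) \<longlonglongrightarrow> d"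
      using tendsto_add[OF tendsto_const LIMSEQ_inverse_real_of_nat, of d] by simp
    show "(\<lambda>n. d) \<longlonglongrightarrow> d" by simp
  qed
  \<comment> \<open>In the parallelogram law for \<open>x - s m\<close> and \<open>x - s n\<close>
    the sum is twice the vector from the midpoint to \<open>x\<close>, so its norm is at least
    \<open>2 * d\<close>; the difference has the norm of \<open>s m - s n\<close>.\<close>
  have ineq: "(norm (s m - s n))\<^sup>2 \<le> 2 * ((norm (x - s m))\<^sup>2 - d\<^sup>2) + 2 * ((norm (x - s n))\<^sup>2 - d\<^sup>2)" for m n
  proof -
    have "(1/2) *\<^sub>R (s m + s n) \<in> S"
      using s S by (intro csubspace_scaleR complex_vector.subspace_add) auto
    then have "d \<le> norm (x - (1/2) *\<^sub>R (s m + s n))"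
      by (rule d_le)
    moreover have "norm ((x - s m) + (x - s n)) = 2 * norm (x - (1/2) *\<^sub>R (s m + s n))"
    proof -
      have "(x - s m) + (x - s n) = 2 *\<^sub>R (x - (1/2) *\<^sub>R (s m + s n))"
        by (simp add: algebra_simps scaleR_2)
      then show ?thesis by simp
    qed
    ultimately have "(2 * d)\<^sup>2 \<le> (norm ((x - s m) + (x - s n)))\<^sup>2"
      using d0 by (intro power_mono) auto
    moreover have "norm ((x - s m) - (x - s n)) = norm (s m - s n)"
      by (simp add: norm_minus_commute)
    ultimately show ?thesis
      using parallelogram_law[of "x - s m" "x - s n"] by (simp add: power_mult_distrib)
  qed
  have "Cauchy s"
  proof (rule CauchyI)
    fix e :: real assume e: "e > 0"
    have "(\<lambda>n. (norm (x - s n))\<^sup>2 - d\<^sup>2) \<longlonglongrightarrow> d\<^sup>2 - d\<^sup>2"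
      using lim by (intro tendsto_intros)
    \<comment> \<open>Both terms on the right of \<open>ineq\<close> carry a factor 2, so the bound
      \<open>e\<^sup>2 / 4\<close> on each excess adds up to \<open>e\<^sup>2\<close>.\<close>
    then have "eventually (\<lambda>n. (norm (x - s n))\<^sup>2 - d\<^sup>2 < e\<^sup>2 / 4) sequentially"
      using e by (intro order_tendstoD(2)) auto
    then obtain M where M: "\<And>n. n \<ge> M \<Longrightarrow> (norm (x - s n))\<^sup>2 - d\<^sup>2 < e\<^sup>2 / 4"
      by (auto simp: eventually_sequentially)
    have "norm (s m - s n) < e" if "m \<ge> M" "n \<ge> M" for m n
      using ineq[of m n] M[OF that(1)] M[OF that(2)] e
      by (intro power2_less_imp_less[of _ e]) auto
    then show "\<exists>M. \<forall>m\<ge>M. \<forall>n\<ge>M. norm (s m - s n) < e"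
      by blast
  qed
  then obtain y where y: "s \<longlonglongrightarrow> y"
    using Cauchy_convergent convergent_def by blast
  have "y \<in> S"
    using \<open>closed S\<close> s(1) y closed_sequentially by blast
  moreover have "norm (x - y) = d"
    using y by (intro LIMSEQ_unique[OF _ lim] tendsto_intros)
  ultimately show ?thesis
    using that d_le by auto
qed

text \<open>First variation at the nearest point: if \<open>x - y\<close> had a nonzero inner
  product with some \<open>z\<close> in \<open>S\<close>, then moving \<open>y\<close> by a small
  multiple of \<open>z\<close> would bring it closer to \<open>x\<close>.\<close>

lemma orthogonal_decomposition:
  fixes S :: "'a::complex_hilbert_space set"
  assumes S: "csubspace S" and "closed S"
  obtains y where "y \<in> S" "\<And>z. z \<in> S \<Longrightarrow> cinner z (x - y) = 0"
proof -
  obtain y where y: "y \<in> S" and min: "\<And>s. s \<in> S \<Longrightarrow> norm (x - y) \<le> norm (x - s)"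
    using csubspace_nearest_point[OF assms] by blast
  have "cinner z (x - y) = 0" if z: "z \<in> S" for z
  proof -
    define t where "t = cinner z (x - y)"
    \<comment> \<open>The shift will be \<open>t / k\<close> times \<open>z\<close>. The factor
      \<open>t\<close> makes its inner product with \<open>x - y\<close> the nonnegative real
      \<open>(cmod t)\<^sup>2 / k\<close>. Adding 1 keeps \<open>k\<close> positive when
      \<open>z = 0\<close> and makes the shift short enough for this linear gain to outweigh the
      quadratic loss unless \<open>t = 0\<close>.\<close>
    define k where "k = (norm z)\<^sup>2 + 1"
    have k: "k > 0"
      by (simp add: k_def add_nonneg_pos)
    define w where "w = scaleC (of_real (1 / k) * t) z"
    have "w \<in> S"
      unfolding w_def by (rule complex_vector.subspace_scale[OF S z])
    then have "norm (x - y) \<le> norm (x - (y + w))"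
      by (intro min complex_vector.subspace_add[OF S y])
    then have "(norm (x - y))\<^sup>2 \<le> (norm ((x - y) - w))\<^sup>2"
      by (intro power_mono) (auto simp: algebra_simps)
    then have "2 * Re (cinner (x - y) w) \<le> (norm w)\<^sup>2"
      by (simp add: norm_sq_diff)
    moreover have "cinner (x - y) w = of_real ((cmod t)\<^sup>2 / k)"
    proof -
      have "cinner (x - y) w = of_real (1 / k) * t * cnj t"
        unfolding w_def t_def by (simp add: cinner_scaleC_right cinner_commute[of "x - y" z])
      also have "\<dots> = of_real ((cmod t)\<^sup>2 / k)"
        by (simp add: mult.assoc flip: complex_norm_square)
      finally show ?thesis .
    qed
    moreover have "(norm w)\<^sup>2 = (cmod t)\<^sup>2 * (norm z)\<^sup>2 / k\<^sup>2"
    proof -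
      define c where "c = of_real (1 / k) * t"
      have "cinner w w = (c * cnj c) * cinner z z"
        by (simp add: w_def c_def cinner_scaleC_left cinner_scaleC_right)
      also have "c * cnj c = of_real ((cmod c)\<^sup>2)"
        by (simp flip: complex_norm_square)
      finally have "(norm w)\<^sup>2 = (cmod c)\<^sup>2 * (norm z)\<^sup>2"
        by (simp add: norm_sq_eq_cinner)
      also have "(cmod c)\<^sup>2 = (cmod t)\<^sup>2 / k\<^sup>2"
        by (simp add: c_def norm_mult norm_divide power_divide)
      finally show ?thesis by simp
    qed
    ultimately have "2 * (cmod t)\<^sup>2 / k \<le> (cmod t)\<^sup>2 * (norm z)\<^sup>2 / k\<^sup>2"
      by simp
    then have "2 * (cmod t)\<^sup>2 * k \<le> (cmod t)\<^sup>2 * (norm z)\<^sup>2"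
      using k by (simp add: field_simps power2_eq_square)
    then have "(cmod t)\<^sup>2 * ((norm z)\<^sup>2 + 2) \<le> 0"
      by (simp add: k_def algebra_simps)
    moreover have "(norm z)\<^sup>2 + 2 > 0"
      by (simp add: add_nonneg_pos)
    ultimately have "(cmod t)\<^sup>2 \<le> 0"
      by (simp add: mult_le_0_iff)
    then show ?thesis
      by (simp add: t_def)
  qed
  then show ?thesis
    using that y by blast
qed

section \<open>The orthogonal projection onto a closed subspace\<close>

lemma proj_eqI:
  fixes S :: "'a::complex_hilbert_space set"
  assumes S: "csubspace S" and y: "y \<in> S" "\<And>z. z \<in> S \<Longrightarrow> cinner z (x - y) = 0"
  shows "proj S x = y"
  unfolding proj_def
proof (rule the_equality)
  fix y' assume y': "y' \<in> S \<and> (\<forall>z\<in>S. cinner z (x - y') = 0)"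
  have d: "y - y' \<in> S"
    using S y y' complex_vector.subspace_diff by blast
  \<comment> \<open>The vector \<open>y - y'\<close> lies in \<open>S\<close> and is also the
    difference of two residuals orthogonal to \<open>S\<close>, hence is orthogonal to
    itself.\<close>
  have "cinner (y - y') (y - y') = cinner (y - y') ((x - y') - (x - y))"
    by simp
  also have "\<dots> = 0"
    unfolding cinner_diff_right[of _ "x - y'"] using y' y(2) d by auto
  finally show "y' = y"
    by (simp add: cinner_eq_zero_iff)
qed (use y in auto)

context
  fixes S :: "'a::complex_hilbert_space set"
  assumes S: "csubspace S" and cl: "closed S"
begin

lemma proj_in: "proj S x \<in> S"
  using orthogonal_decomposition[OF S cl] proj_eqI[OF S] by metis

lemma proj_orthogonal: "z \<in> S \<Longrightarrow> cinner z (x - proj S x) = 0"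
  using orthogonal_decomposition[OF S cl] proj_eqI[OF S] by metis

lemma proj_fixes: "x \<in> S \<Longrightarrow> proj S x = x"
  by (intro proj_eqI[OF S]) auto

lemma range_proj: "range (proj S) = S"
  using proj_in proj_fixes by (metis image_subset_iff rangeI subsetI subset_antisym)

lemma proj_add: "proj S (x + y) = proj S x + proj S y"
proof (rule proj_eqI[OF S])
  fix z assume "z \<in> S"
  then show "cinner z (x + y - (proj S x + proj S y)) = 0"
    using proj_orthogonal[of z x] proj_orthogonal[of z y]
    by (simp add: cinner_diff_right cinner_add_right)
qed (intro complex_vector.subspace_add[OF S] proj_in)

lemma proj_scaleC: "proj S (scaleC c x) = scaleC c (proj S x)"
proof (rule proj_eqI[OF S])
  fix z assume "z \<in> S"
  then show "cinner z (scaleC c x - scaleC c (proj S x)) = 0"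
    using proj_orthogonal[of z x] by (simp add: cinner_diff_right cinner_scaleC_right)
qed (intro complex_vector.subspace_scale[OF S] proj_in)

lemma norm_proj_le: "norm (proj S x) \<le> norm x"
proof -
  have "(norm x)\<^sup>2 = (norm (proj S x))\<^sup>2 + (norm (x - proj S x))\<^sup>2"
    using norm_sq_add[of "proj S x" "x - proj S x"] proj_orthogonal[OF proj_in] by simp
  then have "(norm (proj S x))\<^sup>2 \<le> (norm x)\<^sup>2"
    by simp
  then show ?thesis
    by (rule power2_le_imp_le) simp
qed

lemma cinner_proj: "cinner (proj S x) y = cinner x (proj S y)"
proof -
  \<comment> \<open>Both sides of the claim reduce to the symmetric expression
    \<open>cinner (proj S x) (proj S y)\<close>.\<close>
  have "cinner (proj S x) y = cinner (proj S x) (proj S y)"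
    using proj_orthogonal[OF proj_in, of x y] by (simp add: cinner_diff_right)
  moreover have "cinner (x - proj S x) (proj S y) = 0"
    using proj_orthogonal[OF proj_in, of y x] cinner_commute[of "x - proj S x"] by simp
  ultimately show ?thesis
    by (simp add: cinner_diff_left)
qed

lemma proj_mem_projections: "proj S \<in> projections"
proof -
  have "bounded_linear (proj S)"
  proof (rule bounded_linear_intro)
    show "proj S (r *\<^sub>R x) = r *\<^sub>R proj S x" for r x
      using proj_scaleC[of "of_real r" x] by (simp add: scaleC_of_real)
    show "norm (proj S x) \<le> norm x * 1" for x
      by (simp add: norm_proj_le)
  qed (rule proj_add)
  then show ?thesis
    by (auto simp: projections_def bounded_ops_def proj_scaleC cinner_proj proj_fixes proj_in)
qed

text \<open>A self-adjoint operator that maps \<open>S\<close> into itself also preserves the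
  orthogonal complement of \<open>S\<close>. Applying \<open>P\<close> to the decomposition of
  \<open>x\<close> therefore yields the decomposition of \<open>P x\<close>.\<close>

lemma proj_commutes_invariant:
  assumes P: "P \<in> projections" and inv: "\<And>x. x \<in> S \<Longrightarrow> P x \<in> S"
  shows "proj S (P x) = P (proj S x)"
proof (rule proj_eqI[OF S])
  fix z assume "z \<in> S"
  then have "cinner (P z) (x - proj S x) = 0"
    by (intro proj_orthogonal inv)
  moreover have "cinner (P z) (x - proj S x) = cinner z (P (x - proj S x))"
    using P by (auto simp: projections_def)
  moreover have "P (x - proj S x) = P x - P (proj S x)"
    using P by (auto simp: projections_def bounded_ops_def linear_simps)
  ultimately show "cinner z (P x - P (proj S x)) = 0"
    by simp
qed (intro inv proj_in)

end

section \<open>Bounded operators, ranges of projections and meets\<close>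

lemma bounded_ops_linear:
  assumes "T \<in> bounded_ops"
  shows "T (x + y) = T x + T y" "T (x - y) = T x - T y" "T 0 = 0" "T (scaleC c x) = scaleC c (T x)"
    and "continuous_on UNIV T"
  using assms
  by (auto simp: bounded_ops_def linear_simps linear_continuous_on)

lemma bounded_ops_comp: "S \<in> bounded_ops \<Longrightarrow> T \<in> bounded_ops \<Longrightarrow> S \<circ> T \<in> bounded_ops"
  by (auto simp: bounded_ops_def comp_def intro: bounded_linear_compose)

lemma projections_range_iff:
  assumes "P \<in> projections"
  shows "x \<in> range P \<longleftrightarrow> P x = x"
  using assms by (auto simp: projections_def fun_eq_iff) (metis rangeI)

lemma csubspace_range_projection:
  assumes "P \<in> projections"
  shows "csubspace (range P)"
proof -
  have "P \<in> bounded_ops"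
    using assms by (simp add: projections_def)
  then show ?thesis
    by (auto simp: complex_vector.subspace_def projections_range_iff[OF assms] bounded_ops_linear)
qed

text \<open>Commutation puts \<open>P (Q x)\<close> into both ranges. Self-adjointness moves the
  product onto a vector \<open>z\<close> of the intersection, which both projections fix, so the
  residual is orthogonal to \<open>z\<close>.\<close>

lemma pmeet_commuting:
  assumes P: "P \<in> projections" and Q: "Q \<in> projections" and PQ: "P \<circ> Q = Q \<circ> P"
  shows "pmeet P Q = P \<circ> Q"
proof
  fix x
  have P': "P \<in> bounded_ops" "\<And>x. P (P x) = P x" "\<And>x y. cinner (P x) y = cinner x (P y)"
    using P by (auto simp: projections_def fun_eq_iff)
  have Q': "\<And>x. Q (Q x) = Q x" "\<And>x y. cinner (Q x) y = cinner x (Q y)"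
    using Q by (auto simp: projections_def fun_eq_iff)
  have c: "P (Q x) = Q (P x)" for x
    using PQ by (auto simp: fun_eq_iff)
  have "proj (range P \<inter> range Q) x = P (Q x)"
  proof (rule proj_eqI)
    show "csubspace (range P \<inter> range Q)"
      using P Q by (intro complex_vector.subspace_inter csubspace_range_projection)
    show "P (Q x) \<in> range P \<inter> range Q"
      using rangeI[of P "Q x"] rangeI[of Q "P x"] by (simp only: c[of x] Int_iff)
    fix z assume "z \<in> range P \<inter> range Q"
    then have z: "P z = z" "Q z = z"
      using projections_range_iff P Q by blast+
    have "cinner z (P (Q x)) = cinner (Q (P z)) x"
      by (simp only: P'(3) Q'(2))
    then show "cinner z (x - P (Q x)) = 0"
      by (simp add: z cinner_diff_right)
  qed
  then show "pmeet P Q x = (P \<circ> Q) x"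
    by (simp add: pmeet_def)
qed

section \<open>The joint kernel of the commutators\<close>

lemma commutant_comp:
  assumes "S \<in> commutant \<A>" "T \<in> commutant \<A>"
  shows "S \<circ> T \<in> commutant \<A>"
  using assms unfolding commutant_def by (auto simp: bounded_ops_comp fun_eq_iff)

lemma commutantD: "T \<in> commutant \<A> \<Longrightarrow> S \<in> \<A> \<Longrightarrow> T (S x) = S (T x)"
  by (auto simp: commutant_def fun_eq_iff)

lemma subset_bicommutant: "\<A> \<subseteq> bounded_ops \<Longrightarrow> \<A> \<subseteq> commutant (commutant \<A>)"
  by (auto simp: commutant_def)

lemma pcommutant_subset_commutant: "pcommutant \<A> \<subseteq> commutant \<A>"
  by (auto simp: pcommutant_def commutant_def projections_def)

definition commutator_kernel :: "('a \<Rightarrow> 'a) set \<Rightarrow> 'a::complex_hilbert_space set" where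
  "commutator_kernel \<M> = {\<psi>. \<forall>X\<in>\<M>. \<forall>Y\<in>\<M>. commutator X Y \<psi> = 0}"

lemma commutator_kernel_iff:
  "\<psi> \<in> commutator_kernel \<M> \<longleftrightarrow> (\<forall>X\<in>\<M>. \<forall>Y\<in>\<M>. X (Y \<psi>) = Y (X \<psi>))"
  by (auto simp: commutator_kernel_def commutator_def)

lemma csubspace_commutator_kernel:
  assumes "\<M> \<subseteq> bounded_ops"
  shows "csubspace (commutator_kernel \<M>)"
  using assms
  by (auto simp: complex_vector.subspace_def commutator_kernel_iff bounded_ops_linear subset_iff)

lemma closed_commutator_kernel:
  assumes "\<M> \<subseteq> bounded_ops"
  shows "closed (commutator_kernel \<M>)"
proof -
  have "continuous_on UNIV (\<lambda>\<psi>. X (Y \<psi>))" if "X \<in> \<M>" "Y \<in> \<M>" for X Y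
    using bounded_ops_linear(5)[OF bounded_ops_comp[of X Y]] that assms by (auto simp: comp_def)
  then have "closed (\<Inter>X\<in>\<M>. \<Inter>Y\<in>\<M>. {\<psi>. X (Y \<psi>) = Y (X \<psi>)})"
    by (intro closed_INT ballI closed_Collect_eq)
  moreover have "commutator_kernel \<M> = (\<Inter>X\<in>\<M>. \<Inter>Y\<in>\<M>. {\<psi>. X (Y \<psi>) = Y (X \<psi>)})"
    by (auto simp: commutator_kernel_iff)
  ultimately show ?thesis
    by simp
qed

text \<open>The kernel condition is used for the pair \<open>X\<close>, \<open>Y \<circ> Z\<close>
  and then for the pair \<open>X\<close>, \<open>Z\<close>; closure under composition makes the
  first pair admissible.\<close>

lemma commutator_kernel_invariant:
  assumes comp: "\<And>X Y. X \<in> \<M> \<Longrightarrow> Y \<in> \<M> \<Longrightarrow> X \<circ> Y \<in> \<M>"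
    and Z: "Z \<in> \<M>" and \<psi>: "\<psi> \<in> commutator_kernel \<M>"
  shows "Z \<psi> \<in> commutator_kernel \<M>"
  unfolding commutator_kernel_iff
proof (intro ballI)
  fix X Y assume X: "X \<in> \<M>" and Y: "Y \<in> \<M>"
  have "X (Y (Z \<psi>)) = Y (Z (X \<psi>))"
    using \<psi> X comp[OF Y Z] by (auto simp: commutator_kernel_iff comp_def)
  also have "\<dots> = Y (X (Z \<psi>))"
    using \<psi> X Z by (simp add: commutator_kernel_iff)
  finally show "X (Y (Z \<psi>)) = Y (X (Z \<psi>))" .
qed

text \<open>An operator commuting with \<open>X\<close> and \<open>Y\<close> commutes with their
  commutator and so preserves its kernel. This serves to place the projection onto the kernel in the
  logic.\<close>

lemma commutator_kernel_invariant_commutant: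
  assumes "T \<in> commutant \<M>" "\<psi> \<in> commutator_kernel \<M>"
  shows "T \<psi> \<in> commutator_kernel \<M>"
  using assms commutantD[OF assms(1)] unfolding commutator_kernel_iff by metis

lemma range_subset_commutator_kernel:
  assumes \<A>: "\<A> \<subseteq> bounded_ops" and E: "E \<in> commutant \<A>"
    and comm: "\<And>P1 P2 x. P1 \<in> \<A> \<Longrightarrow> P2 \<in> \<A> \<Longrightarrow> P1 (P2 (E x)) = P2 (P1 (E x))"
  shows "range E \<subseteq> commutator_kernel (commutant (commutant \<A>))"
proof -
  have E': "E \<in> bounded_ops" "\<And>P x. P \<in> \<A> \<Longrightarrow> E (P x) = P (E x)"
    using E by (auto simp: commutant_def fun_eq_iff)
  \<comment> \<open>For \<open>Q\<close> in \<open>\<A>\<close>, \<open>E\<close> moves past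
    \<open>Q\<close>, and \<open>comm\<close> then exchanges \<open>P\<close> and \<open>Q\<close>
    in front of \<open>E\<close>.\<close>
  have PE: "P \<circ> E \<in> commutant \<A>" if "P \<in> \<A>" for P
    using that \<A> E' comm by (auto simp: commutant_def fun_eq_iff intro: bounded_ops_comp)
  have XE: "X \<circ> E \<in> commutant \<A>" if X: "X \<in> commutant (commutant \<A>)" for X
  proof -
    have "X (E (P x)) = P (X (E x))" if P: "P \<in> \<A>" for P x
    proof -
      \<comment> \<open>\<open>X\<close> commutes with \<open>P \<circ> E\<close> by
        \<open>PE\<close>, and \<open>E (P x)\<close> equals \<open>P (E x)\<close>.\<close>
      have "X (E (P x)) = P (E (X x))"
        using commutantD[OF X PE[OF P], of x] E'(2)[OF P] by simp
      then show ?thesis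
        by (simp add: commutantD[OF X E])
    qed
    then show ?thesis
      using X E' by (auto simp: commutant_def fun_eq_iff intro: bounded_ops_comp)
  qed
  have "X (Y (E x)) = Y (X (E x))"
    if X: "X \<in> commutant (commutant \<A>)" and Y: "Y \<in> commutant (commutant \<A>)" for X Y x
    using commutantD[OF Y XE[OF X], of x] commutantD[OF Y E, of x] by simp
  then show ?thesis
    by (auto simp: commutator_kernel_iff)
qed

theorem theorem2p6:
  fixes \<Q> \<A> :: "('a \<Rightarrow> 'a::complex_hilbert_space) set"
  assumes "quantum_logic \<Q>"
    and "\<A> \<subseteq> \<Q>"
  shows "cdom \<Q> \<A> =
    proj {\<psi>. \<forall>X\<in>commutant (commutant \<A>). \<forall>Y\<in>commutant (commutant \<A>). commutator X Y \<psi> = 0}"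
proof -
  define \<M> where "\<M> = commutant (commutant \<A>)"
  define N where "N = commutator_kernel \<M>"
  define \<E> where "\<E> = {E \<in> pcommutant \<A> \<inter> \<Q>.
     \<forall>P1\<in>\<A>. \<forall>P2\<in>\<A>. pmeet P1 E \<circ> pmeet P2 E = pmeet P2 E \<circ> pmeet P1 E}"
  have \<A>: "\<A> \<subseteq> projections" and \<A>b: "\<A> \<subseteq> bounded_ops"
    using assms by (auto simp: quantum_logic_def projections_def)
  have \<A>\<M>: "\<A> \<subseteq> \<M>"
    unfolding \<M>_def by (rule subset_bicommutant[OF \<A>b])
  have \<M>: "\<M> \<subseteq> bounded_ops"
    by (auto simp: \<M>_def commutant_def)
  have N: "csubspace N" "closed N"
    unfolding N_def using \<M> by (auto intro: csubspace_commutator_kernel closed_commutator_kernel)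
  \<comment> \<open>Each meet is a product by \<open>pmeet_commuting\<close>, and the inner
    \<open>E\<close> is absorbed by commutation and idempotence. The condition defining
    \<open>\<E>\<close> thus says that the members of \<open>\<A>\<close> commute on the range of
    \<open>E\<close>.\<close>
  have meet: "(pmeet P1 E \<circ> pmeet P2 E) x = P1 (P2 (E x))"
    if "E \<in> pcommutant \<A>" "P1 \<in> \<A>" "P2 \<in> \<A>" for E P1 P2 x
  proof -
    have E: "E \<in> projections" "\<And>P x. P \<in> \<A> \<Longrightarrow> E (P x) = P (E x)" "\<And>x. E (E x) = E x"
      using that(1) by (auto simp: pcommutant_def projections_def fun_eq_iff)
    have "pmeet P E = P \<circ> E" if "P \<in> \<A>" for P
      using that \<A> E by (intro pmeet_commuting) (auto simp: fun_eq_iff)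
    then show ?thesis
      using that by (simp add: E)
  qed
  have sub: "range E \<subseteq> N" if "E \<in> \<E>" for E
    unfolding N_def \<M>_def
  proof (rule range_subset_commutator_kernel[OF \<A>b])
    have E: "E \<in> pcommutant \<A>"
      using that by (simp add: \<E>_def)
    then show "E \<in> commutant \<A>"
      using pcommutant_subset_commutant by blast
    show "P1 (P2 (E x)) = P2 (P1 (E x))" if P: "P1 \<in> \<A>" "P2 \<in> \<A>" for P1 P2 x
    proof -
      have "pmeet P1 E \<circ> pmeet P2 E = pmeet P2 E \<circ> pmeet P1 E"
        using \<open>E \<in> \<E>\<close> P by (simp add: \<E>_def)
      then show ?thesis
        using meet[OF E P] meet[OF E P(2,1)] by metis
    qed
  qed
  have "proj N \<in> \<E>"
  proof -
    have E: "proj N \<in> projections"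
      by (rule proj_mem_projections[OF N])
    have "P x \<in> N" if "P \<in> \<A>" "x \<in> N" for P x
      unfolding N_def
    proof (rule commutator_kernel_invariant[where Z = P and \<psi> = x])
      show "P \<in> \<M>" "x \<in> commutator_kernel \<M>"
        using that \<A>\<M> by (auto simp: N_def)
    qed (unfold \<M>_def, rule commutant_comp)
    then have "proj N \<circ> P = P \<circ> proj N" if "P \<in> \<A>" for P
      unfolding fun_eq_iff comp_apply using that \<A> by (blast intro: proj_commutes_invariant[OF N])
    then have EA: "proj N \<in> pcommutant \<A>"
      using E by (simp add: pcommutant_def)
    have "R x \<in> N" if R: "R \<in> pcommutant \<Q>" and x: "x \<in> N" for R x
    proof -
      have "R \<in> pcommutant \<A>"
        using R assms(2) by (auto simp: pcommutant_def)
      then have "R \<in> commutant \<A>"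
        using pcommutant_subset_commutant by blast
      \<comment> \<open>This is the inclusion of A' in A''', the bicommutant inclusion applied to A'
        itself.\<close>
      then have "R \<in> commutant \<M>"
        unfolding \<M>_def
        by (intro subsetD[OF subset_bicommutant]) (auto simp: commutant_def)
      then show ?thesis
        using x unfolding N_def by (rule commutator_kernel_invariant_commutant)
    qed
    moreover have "pcommutant \<Q> \<subseteq> projections"
      by (auto simp: pcommutant_def)
    ultimately have "proj N \<circ> R = R \<circ> proj N" if "R \<in> pcommutant \<Q>" for R
      unfolding fun_eq_iff comp_apply using that by (blast intro: proj_commutes_invariant[OF N])
    then have "proj N \<in> pcommutant (pcommutant \<Q>)"
      using E unfolding pcommutant_def[of "pcommutant \<Q>"] by blast
    then have EQ: "proj N \<in> \<Q>"
      using assms(1) by (simp add: quantum_logic_def)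
    have "pmeet P1 (proj N) \<circ> pmeet P2 (proj N) = pmeet P2 (proj N) \<circ> pmeet P1 (proj N)"
      if P: "P1 \<in> \<A>" "P2 \<in> \<A>" for P1 P2
    proof
      fix x
      \<comment> \<open>\<open>P1\<close> and \<open>P2\<close> belong to \<open>\<M>\<close>, so
        their commutator annihilates \<open>proj N x\<close>, a vector of \<open>N\<close>.\<close>
      have "P1 (P2 (proj N x)) = P2 (P1 (proj N x))"
        using proj_in[OF N, of x] P \<A>\<M> by (auto simp: N_def commutator_kernel_iff)
      then show "(pmeet P1 (proj N) \<circ> pmeet P2 (proj N)) x = (pmeet P2 (proj N) \<circ> pmeet P1 (proj N)) x"
        unfolding meet[OF EA P] meet[OF EA P(2,1)] .
    qed
    then show ?thesis
      using EA EQ by (simp add: \<E>_def)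
  qed
  \<comment> \<open>As \<open>proj N\<close> is itself in the family, the union of the ranges is
    already \<open>N\<close>, and taking span and closure adds nothing.\<close>
  then have "N \<subseteq> (\<Union>E\<in>\<E>. range E)"
    using range_proj[OF N] by blast
  with sub have "(\<Union>E\<in>\<E>. range E) = N"
    by blast
  moreover have "closure (cspan N) = N"
    using N by (simp add: complex_vector.span_eq_iff[THEN iffD2])
  ultimately have "pJoin \<E> = proj N"
    by (simp add: pJoin_def)
  then show ?thesis
    by (simp add: cdom_def \<E>_def N_def \<M>_def commutator_kernel_def)
qed

end
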